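(* Let $t, w, v$ be positive integers. Every $t$-traceability scheme $t$-TS$(w,v)$ is a $t^2$-cover-free family $t^2$-CFF$(w,v)$.
   Context: A set system is a pair $(\mathcal{X},\mathcal{B})$ where $\mathcal{X}$ is a finite set of points and $\mathcal{B}$ is a collection (set) of subsets of $\mathcal{X}$ called blocks. $\binom{\mathcal{X}}{w}$ denotes the collection of all $w$-subsets of $\mathcal{X}$. Let $|\mathcal{X}|=v$ and $\mathcal{B}\subseteq\binom{\mathcal{X}}{w}$. $(\mathcal{X},\mathcal{B})$ is a $t$-TS$(w,v)$ if for every choice of $s$ blocks $B_1,\ldots,B_s\in\mathcal{B}$ with $1\le s\le t$ and for any $w$-subset $T\subseteq\bigcup_{1\le j\le s}B_j$, there does not exist a block $B\in\mathcal{B}\setminus\{B_1,\ldots,B_s\}$ such that $|T\cap B|\ge|T\cap B_j|$ for all $1\le j\le s$. For a positive integer $r$, $(\mathcal{X},\mathcal{B})$ is an $r$-CFF$(w,v)$ if for any $r+1$ distinct blocks $B_0,B_1,\ldots,B_r\in\mathcal{B}$ we have $B_0\nsubseteq\bigcup_{1\le i\le r}B_i$. *)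

theory Defs
  imports "HOL-Library.Ramsey"
begin

definition uniform_set_system :: "nat \<Rightarrow> nat \<Rightarrow> 'a set \<Rightarrow> 'a set set \<Rightarrow> bool" where
  "uniform_set_system w v \<X> \<B> \<longleftrightarrow> finite \<X> \<and> card \<X> = v \<and> \<B> \<subseteq> nsets \<X> w"

text \<open>A choice of blocks \<open>B\<^sub>1, \<dots>, B\<^sub>s\<close> is represented by the set \<open>\<C> = {B\<^sub>1, \<dots>, B\<^sub>s}\<close>; a choice with
  repetitions yields a smaller nonempty set, so nothing depends on whether the blocks chosen in a
  traceability scheme are required to be distinct.\<close>

definition traceability_scheme :: "nat \<Rightarrow> nat \<Rightarrow> nat \<Rightarrow> 'a set \<Rightarrow> 'a set set \<Rightarrow> bool" where
  "traceability_scheme t w v \<X> \<B> \<longleftrightarrow>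
     uniform_set_system w v \<X> \<B> \<and>
     (\<forall>\<C> T. \<C> \<subseteq> \<B> \<and> 1 \<le> card \<C> \<and> card \<C> \<le> t \<and> T \<in> nsets (\<Union>\<C>) w \<longrightarrow>
        \<not> (\<exists>B \<in> \<B> - \<C>. \<forall>C \<in> \<C>. card (T \<inter> B) \<ge> card (T \<inter> C)))"

definition cover_free_family :: "nat \<Rightarrow> nat \<Rightarrow> nat \<Rightarrow> 'a set \<Rightarrow> 'a set set \<Rightarrow> bool" where
  "cover_free_family r w v \<X> \<B> \<longleftrightarrow>
     uniform_set_system w v \<X> \<B> \<and>
     (\<forall>\<C> B\<^sub>0. \<C> \<subseteq> \<B> \<and> card \<C> = r \<and> B\<^sub>0 \<in> \<B> - \<C> \<longrightarrow> \<not> B\<^sub>0 \<subseteq> \<Union>\<C>)"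

end

theory Submission
  imports Defs
begin

text \<open>
  Suppose \<open>B\<^sub>0\<close> is covered by \<open>t\<^sup>2\<close> other blocks. Let \<open>x\<close> be the largest size of the intersection of
  one of them with \<open>B\<^sub>0\<close>, and choose \<open>t\<close> of them, including one attaining \<open>x\<close>, whose union \<open>U\<close> meets
  \<open>B\<^sub>0\<close> in \<open>m\<close> points; by averaging over the remaining \<open>t\<^sup>2 - 1\<close> blocks one can ensure
  \<open>w - x \<le> (t + 1)(m - x)\<close>, that is, \<open>w - m \<le> t (m - x)\<close>. Let \<open>y\<close> be the minimum of \<open>m - x\<close> and
  \<open>w - m\<close>, and let the private part of a chosen block consist of its points lying neither in \<open>B\<^sub>0\<close> nor
  in another chosen block.

  If every private part has at least \<open>y\<close> points, then \<open>B\<^sub>0 \<inter> U\<close> together with \<open>w - m\<close> private points,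
  at most \<open>y\<close> from each block, frames \<open>B\<^sub>0\<close>: each chosen block contains at most \<open>x + y \<le> m\<close> of these
  points. Otherwise some chosen block \<open>C\<close> has \<open>e < y\<close> private points. Replace them by \<open>e\<close> points of
  \<open>B\<^sub>0 - U\<close>; the result is covered by \<open>B\<^sub>0\<close> and the other \<open>t - 1\<close> chosen blocks and frames \<open>C\<close>, since
  \<open>x + 2 e \<le> w\<close>.
\<close>

text \<open>Discarding a lightest element never lowers the average of \<open>p\<close>, so this can
  be repeated until \<open>k\<close> elements remain.\<close>

lemma exists_heavy_subset:
  fixes p :: "'b \<Rightarrow> nat"
  assumes "finite F" "k \<le> card F"
  shows "\<exists>G\<subseteq>F. card G = k \<and> k * sum p F \<le> card F * sum p G"
  using assms
proof (induction "card F" arbitrary: F)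
  case 0
  then show ?case by (intro exI[of _ "{}"]) auto
next
  case (Suc n)
  show ?case
  proof (cases "k = Suc n")
    case True
    then show ?thesis using Suc.hyps(2) by (intro exI[of _ F]) auto
  next
    case False
    then have kn: "k \<le> n" using Suc.prems Suc.hyps(2) by simp
    have "F \<noteq> {}" using Suc.hyps(2) by auto
    then obtain a where a: "a \<in> F" "\<And>b. b \<in> F \<Longrightarrow> p a \<le> p b"
      using finite_imageI[OF Suc.prems(1), of p] Min_in[of "p ` F"] Min_le[of "p ` F"]
      by (smt (verit) imageE image_eqI image_is_empty)
    have card': "card (F - {a}) = n" using Suc.hyps(2) Suc.prems(1) a(1) by simp
    obtain G where G: "G \<subseteq> F - {a}" "card G = k" "k * sum p (F - {a}) \<le> n * sum p G"
      using Suc.hyps(1)[of "F - {a}"] card' kn Suc.prems(1) by auto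
    have split: "sum p F = p a + sum p (F - {a})"
      using Suc.prems(1) a(1) by (rule sum.remove)
    have "card (F - {a}) * p a \<le> sum p (F - {a})"
      using sum_bounded_below[of "F - {a}" "p a" p] a(2) by simp
    then have light: "n * sum p F \<le> Suc n * sum p (F - {a})"
      unfolding split card' by (simp add: algebra_simps)
    have "k * sum p F \<le> Suc n * sum p G"
    \<comment> \<open>The factor \<open>n\<close> is cancelled at the end, so it has to be
      positive.\<close>
    proof (cases "n = 0")
      case True
      then show ?thesis using kn by simp
    next
      case False
      have "n * (k * sum p F) = k * (n * sum p F)" by simp
      also have "\<dots> \<le> k * (Suc n * sum p (F - {a}))" using light by (rule mult_left_mono) simp
      also have "\<dots> = Suc n * (k * sum p (F - {a}))" by (simp only: mult.left_commute)
      also have "\<dots> \<le> Suc n * (n * sum p G)" using G(3) by (rule mult_left_mono) simp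
      also have "\<dots> = n * (Suc n * sum p G)" by (simp only: mult.left_commute)
      finally show ?thesis using False by simp
    qed
    then show ?thesis using G Suc.hyps(2) by (intro exI[of _ G]) auto
  qed
qed

text \<open>Assign each point of \<open>U\<close> to one block containing it. Weighting blocks by
  the number of points assigned to them gives total weight \<open>card U\<close>, and a heavy
  subfamily covers at least its own weight.\<close>

lemma exists_subfamily_covering_fraction:
  assumes "finite F" "k \<le> card F" "finite U" "U \<subseteq> \<Union>F"
  shows "\<exists>G\<subseteq>F. card G = k \<and> k * card U \<le> card F * card (U \<inter> \<Union>G)"
proof -
  have "\<forall>u\<in>U. \<exists>A. A \<in> F \<and> u \<in> A" using assms(4) by blast
  then obtain f where f: "\<forall>u\<in>U. f u \<in> F \<and> u \<in> f u" by (rule bchoice[THEN exE])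
  define p where "p A = card {u \<in> U. f u = A}" for A
  have sum_p: "sum p G = card {u \<in> U. f u \<in> G}" if "G \<subseteq> F" for G
  proof -
    have "{u \<in> U. f u \<in> G} = (\<Union>A\<in>G. {u \<in> U. f u = A})" by blast
    moreover have "card (\<Union>A\<in>G. {u \<in> U. f u = A}) = sum p G"
      unfolding p_def using assms that by (intro card_UN_disjoint) (auto intro: finite_subset)
    ultimately show ?thesis by simp
  qed
  obtain G where G: "G \<subseteq> F" "card G = k" "k * sum p F \<le> card F * sum p G"
    using exists_heavy_subset[OF assms(1,2)] by blast
  have "sum p F = card U" using sum_p[of F] f by (auto intro: arg_cong[where f = card])
  moreover have "sum p G \<le> card (U \<inter> \<Union>G)"
    unfolding sum_p[OF G(1)] using f assms(3) by (intro card_mono) auto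
  ultimately show ?thesis using G by (metis mult_le_mono2 order_trans)
qed

text \<open>After a block with the largest intersection is set aside,
  \<open>t^2 - 1 = (t + 1) * (t - 1)\<close> blocks remain, so some \<open>t - 1\<close> of them
  cover at least a fraction \<open>1 / (t + 1)\<close> of what is left of \<open>B\<close>.\<close>

lemma exists_covering_subfamily_with_max:
  fixes \<C> :: "'a set set"
  assumes "t \<ge> 1" "card \<C> = t^2" "finite B" "B \<subseteq> \<Union>\<C>"
  obtains \<G> x where "\<G> \<subseteq> \<C>" "card \<G> = t"
    "\<And>C. C \<in> \<G> \<Longrightarrow> card (B \<inter> C) \<le> x" "x \<le> card (B \<inter> \<Union>\<G>)"
    "card B - x \<le> (t + 1) * (card (B \<inter> \<Union>\<G>) - x)"
proof -
  have fin: "finite \<C>" and ne: "\<C> \<noteq> {}" using assms(1,2) by (auto intro: card_ge_0_finite)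
  have img: "finite ((\<lambda>C. card (B \<inter> C)) ` \<C>)" "(\<lambda>C. card (B \<inter> C)) ` \<C> \<noteq> {}"
    using fin ne by auto
  obtain C\<^sub>1 where C1: "C\<^sub>1 \<in> \<C>" "\<And>C. C \<in> \<C> \<Longrightarrow> card (B \<inter> C) \<le> card (B \<inter> C\<^sub>1)"
    using Max_in[OF img] Max_ge[OF img(1)] by fastforce
  define x where "x = card (B \<inter> C\<^sub>1)"
  have card': "card (\<C> - {C\<^sub>1}) = (t + 1) * (t - 1)"
    using fin C1(1) assms(1,2) by (simp add: power2_eq_square algebra_simps)
  have le: "t - 1 \<le> card (\<C> - {C\<^sub>1})"
    unfolding card' by simp
  obtain H where H: "H \<subseteq> \<C> - {C\<^sub>1}" "card H = t - 1"
    "(t - 1) * card (B - C\<^sub>1) \<le> card (\<C> - {C\<^sub>1}) * card ((B - C\<^sub>1) \<inter> \<Union>H)"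
    using exists_subfamily_covering_fraction[of "\<C> - {C\<^sub>1}" "t - 1" "B - C\<^sub>1"] le fin assms(3,4) by auto
  have finH: "finite H" using H(1) fin by (meson finite_Diff finite_subset)
  have "card (insert C\<^sub>1 H) = t" using H(1,2) finH assms(1) by (subst card_insert_disjoint) auto
  moreover have "card (B \<inter> \<Union>(insert C\<^sub>1 H)) = x + card ((B - C\<^sub>1) \<inter> \<Union>H)"
  proof -
    have "B \<inter> \<Union>(insert C\<^sub>1 H) = (B \<inter> C\<^sub>1) \<union> ((B - C\<^sub>1) \<inter> \<Union>H)" by blast
    then show ?thesis unfolding x_def using assms(3) by (simp only:) (subst card_Un_disjoint, auto)
  qed
  moreover have "card (B - C\<^sub>1) = card B - x"
    unfolding x_def using assms(3) by (simp add: card_Diff_subset_Int)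
  moreover have "card (B - C\<^sub>1) \<le> (t + 1) * card ((B - C\<^sub>1) \<inter> \<Union>H)"
  \<comment> \<open>For \<open>t = 1\<close> the factor \<open>t - 1\<close> vanishes and cannot be
    cancelled, but then the single block already covers \<open>B\<close>.\<close>
  proof (cases "t = 1")
    case True
    then have "\<C> = {C\<^sub>1}" using assms(2) C1(1) by (auto simp: card_1_singleton_iff)
    then have "B - C\<^sub>1 = {}" using assms(4) by auto
    then show ?thesis by (simp only: card.empty le0)
  next
    case False
    have "(t - 1) * card (B - C\<^sub>1) \<le> (t - 1) * ((t + 1) * card ((B - C\<^sub>1) \<inter> \<Union>H))"
      using H(3) unfolding card' by (simp only: mult_ac)
    then show ?thesis using False assms(1) by simp
  qed
  ultimately show ?thesis
    using C1 H(1) by (intro that[of "insert C\<^sub>1 H" x]) (auto simp: x_def)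
qed

lemma traceability_scheme_not_framed:
  assumes "traceability_scheme t w v \<X> \<B>" "\<C> \<subseteq> \<B>" "1 \<le> card \<C>" "card \<C> \<le> t"
    "T \<subseteq> \<Union>\<C>" "finite T" "card T = w" "B \<in> \<B>" "B \<notin> \<C>"
  shows "\<exists>C\<in>\<C>. card (T \<inter> B) < card (T \<inter> C)"
  using assms unfolding traceability_scheme_def nsets_def by (force simp: not_le)

theorem mainTheorem1:
  fixes t w v :: nat and \<X> :: "'a set" and \<B> :: "'a set set"
  assumes "t \<ge> 1" and "w \<ge> 1" and "v \<ge> 1"
    and "traceability_scheme t w v \<X> \<B>"
  shows "cover_free_family (t^2) w v \<X> \<B>"
proof -
  have unif: "uniform_set_system w v \<X> \<B>"
    using assms(4) by (simp add: traceability_scheme_def)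
  have blk: "finite B" "card B = w" if "B \<in> \<B>" for B
    using unif that by (auto simp: uniform_set_system_def nsets_def)
  have False if C: "\<C> \<subseteq> \<B>" "card \<C> = t^2" and B0: "B\<^sub>0 \<in> \<B>" "B\<^sub>0 \<notin> \<C>" "B\<^sub>0 \<subseteq> \<Union>\<C>" for \<C> B\<^sub>0
  proof -
    obtain \<G> x where G: "\<G> \<subseteq> \<C>" "card \<G> = t"
      and x: "\<And>C. C \<in> \<G> \<Longrightarrow> card (B\<^sub>0 \<inter> C) \<le> x" "x \<le> card (B\<^sub>0 \<inter> \<Union>\<G>)"
      and wx: "card B\<^sub>0 - x \<le> (t + 1) * (card (B\<^sub>0 \<inter> \<Union>\<G>) - x)"
      using exists_covering_subfamily_with_max[OF assms(1) C(2) blk(1)[OF B0(1)] B0(3)] by metis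
    define m where "m = card (B\<^sub>0 \<inter> \<Union>\<G>)"
    \<comment> \<open>The bound \<open>m - x\<close> limits what a chosen block may gain from its
      private part; \<open>w - m\<close> is the number of points of \<open>B\<^sub>0\<close>
      available for replacements.\<close>
    define y where "y = min (m - x) (w - m)"
    define E where "E C = C - (B\<^sub>0 \<union> \<Union>(\<G> - {C}))" for C
    have GB: "\<G> \<subseteq> \<B>" using G C by blast
    have finG: "finite \<G>" using G(2) assms(1) by (intro card_ge_0_finite) simp
    have finB0: "finite B\<^sub>0" and cB0: "card B\<^sub>0 = w" using blk B0(1) by auto
    have B0G: "B\<^sub>0 \<notin> \<G>" using B0(2) G(1) by blast
    have xm: "x \<le> m" using x(2) by (simp add: m_def)
    have mw: "m \<le> w" unfolding m_def cB0[symmetric] by (rule card_mono[OF finB0]) simp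
    have "w - m \<le> t * (m - x)" using wx xm mw unfolding cB0 m_def[symmetric] by simp
    \<comment> \<open>If the minimum is \<open>w - m\<close>, then \<open>t \<ge> 1\<close>
      suffices.\<close>
    then have ty: "w - m \<le> t * y"
      using assms(1) by (cases "m - x \<le> w - m") (auto simp: y_def min_def)
    show False
    proof (cases "\<forall>C\<in>\<G>. y \<le> card (E C)")
      case True
      then have "\<forall>C\<in>\<G>. \<exists>R. R \<subseteq> E C \<and> card R = y \<and> finite R"
        by (meson obtain_subset_with_card_n)
      then obtain R where R: "\<And>C. C \<in> \<G> \<Longrightarrow> R C \<subseteq> E C \<and> card (R C) = y \<and> finite (R C)"
        by metis
      have disj: "R C \<inter> R D = {}" if "C \<in> \<G>" "D \<in> \<G>" "C \<noteq> D" for C D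
        using R[OF that(1)] R[OF that(2)] that unfolding E_def by blast
      have "card (\<Union>C\<in>\<G>. R C) = (\<Sum>C\<in>\<G>. card (R C))"
        using finG R disj by (intro card_UN_disjoint) auto
      also have "\<dots> = t * y" using R G(2) by simp
      finally have "w - m \<le> card (\<Union>C\<in>\<G>. R C)" using ty by simp
      then obtain S where S: "S \<subseteq> (\<Union>C\<in>\<G>. R C)" "card S = w - m" "finite S"
        by (meson obtain_subset_with_card_n)
      define T where "T = (B\<^sub>0 \<inter> \<Union>\<G>) \<union> S"
      have finT: "finite T" using finB0 S(3) by (simp add: T_def)
      have "S \<inter> B\<^sub>0 = {}" using S(1) R unfolding E_def by blast
      then have "card T = m + (w - m)"
        unfolding T_def m_def using finB0 S(2,3) by (subst card_Un_disjoint) (auto simp: m_def)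
      then have cT: "card T = w" using mw by simp
      have "S \<subseteq> \<Union>\<G>" using S(1) R unfolding E_def by blast
      then have "T \<subseteq> \<Union>\<G>" by (auto simp: T_def)
      then obtain C where C: "C \<in> \<G>" "card (T \<inter> B\<^sub>0) < card (T \<inter> C)"
        using traceability_scheme_not_framed[OF assms(4) GB _ _ _ finT cT B0(1) B0G] G(2) assms(1)
        by auto
      \<comment> \<open>The private parts of the other chosen blocks avoid \<open>C\<close>.\<close>
      have "S \<inter> C \<subseteq> R C" using S(1) R C(1) unfolding E_def by blast
      then have "T \<inter> C \<subseteq> (B\<^sub>0 \<inter> C) \<union> R C" unfolding T_def by blast
      then have "card (T \<inter> C) \<le> card ((B\<^sub>0 \<inter> C) \<union> R C)"
        using finB0 R C(1) by (intro card_mono) auto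
      also have "\<dots> \<le> card (B\<^sub>0 \<inter> C) + card (R C)" by (rule card_Un_le)
      also have "\<dots> \<le> x + y" using x(1) R C(1) by (simp add: add_mono)
      also have "\<dots> \<le> m" using xm by (simp add: y_def)
      also have "m \<le> card (T \<inter> B\<^sub>0)"
        unfolding m_def T_def using finB0 by (intro card_mono) auto
      finally show False using C(2) by simp
    next
      case False
      then obtain C where C: "C \<in> \<G>" "card (E C) < y" by (auto simp: not_le)
      define e where "e = card (E C)"
      have finC: "finite C" and cC: "card C = w" using blk C(1) GB by auto
      have ey: "e < m - x" "e < w - m" using C(2) by (auto simp: e_def y_def)
      have "card (B\<^sub>0 - \<Union>\<G>) = w - m"
        unfolding m_def cB0[symmetric] using finB0 by (simp add: card_Diff_subset_Int)
      then obtain S where S: "S \<subseteq> B\<^sub>0 - \<Union>\<G>" "card S = e" "finite S"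
        using ey(2) by (metis less_imp_le obtain_subset_with_card_n)
      define T where "T = (C - E C) \<union> S"
      have finT: "finite T" using finC S(3) by (simp add: T_def)
      have cCE: "card (C - E C) = w - e"
        using finC cC by (subst card_Diff_subset) (auto simp: e_def E_def intro: finite_subset)
      have "card T = (w - e) + e"
        unfolding T_def using finC S C(1) by (subst card_Un_disjoint) (auto simp: cCE)
      then have cT: "card T = w" using ey(2) by simp
      \<comment> \<open>Exchanging \<open>C\<close> for \<open>B\<^sub>0\<close> keeps the number of
        blocks at \<open>t\<close> and leaves \<open>C\<close> outside, where it can be
        framed.\<close>
      let ?K = "insert B\<^sub>0 (\<G> - {C})"
      have cK: "card ?K = t" using finG G(2) C(1) B0G assms(1) by simp
      have KB: "?K \<subseteq> \<B>" using GB B0(1) by blast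
      have TK: "T \<subseteq> \<Union>?K" using S(1) unfolding T_def E_def by blast
      have CK: "C \<in> \<B>" "C \<notin> ?K" using C(1) GB B0G by auto
      obtain A where A: "A \<in> ?K" "card (T \<inter> C) < card (T \<inter> A)"
        using traceability_scheme_not_framed[OF assms(4) KB _ _ TK finT cT CK] cK assms(1) by auto
      have TC: "w - e \<le> card (T \<inter> C)"
        unfolding cCE[symmetric] T_def using finC by (intro card_mono) auto
      have "card (T \<inter> A) \<le> w - e"
      proof (cases "A = B\<^sub>0")
        case True
        have "T \<inter> B\<^sub>0 \<subseteq> (B\<^sub>0 \<inter> C) \<union> S" by (auto simp: T_def)
        then have "card (T \<inter> B\<^sub>0) \<le> card ((B\<^sub>0 \<inter> C) \<union> S)"
          using finB0 S(3) by (intro card_mono) auto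
        also have "\<dots> \<le> card (B\<^sub>0 \<inter> C) + card S" by (rule card_Un_le)
        also have "\<dots> \<le> x + e" using x(1)[OF C(1)] S(2) by simp
        \<comment> \<open>Adding \<open>e < m - x\<close> and \<open>e < w - m\<close> gives
          \<open>2 * e < w - x\<close>.\<close>
        also have "\<dots> \<le> w - e" using ey by linarith
        finally show ?thesis using True by simp
      next
        case False
        \<comment> \<open>Here \<open>A\<close> is in \<open>\<G>\<close>, and \<open>S\<close> lies
          outside the union of \<open>\<G>\<close>.\<close>
        then have "T \<inter> A \<subseteq> C - E C" using A(1) S(1) unfolding T_def by blast
        then show ?thesis unfolding cCE[symmetric] using finC by (intro card_mono) auto
      qed
      then show False using A(2) TC by simp
    qed
  qed
  then show ?thesis unfolding cover_free_family_def using unif by blast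
qed

end
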